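(* Let $x_1,\ldots,x_n \in \mathbb{R}^p$ and $\mu_* \in \mathbb{R}^p$, and let $S = (s_{jk}) = \frac{1}{n}\sum_{i=1}^n (x_i-\mu_* )(x_i-\mu_* )^{\top} \in \mathbb{R}^{p\times p}$. Consider the optimization problem $$\min_{\Omega \in \mathcal{M}^p} \; -\log\det(\Omega) + \operatorname{tr}(\Omega S),$$ and suppose that $S$ has strictly positive diagonal elements. Then, unless there exists $(j,k)$, $j \neq k$, such that $s_{jk} = \sqrt{s_{jj}s_{kk}}$, a minimizer of this problem exists and is unique.
   Context: $\mathcal{M}^p$ denotes the set of real symmetric positive definite $p\times p$ matrices $\Omega = (\omega_{jk})$ with $\omega_{jk} \leq 0$ for all $j \neq k$ (positive definite $M$-matrices). No relation between $n$ and $p$ is assumed (in particular $n<p$ is allowed). *)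

theory Defs
  imports "HOL-Analysis.Analysis"
begin

definition pos_def_matrix :: "real^'p^'p \<Rightarrow> bool" where
  "pos_def_matrix A \<longleftrightarrow> transpose A = A \<and> (\<forall>v. v \<noteq> 0 \<longrightarrow> v \<bullet> (A *v v) > 0)"

definition M_matrices :: "(real^'p^'p) set" where
  "M_matrices = {\<Omega>. pos_def_matrix \<Omega> \<and> (\<forall>j k. j \<noteq> k \<longrightarrow> \<Omega> $ j $ k \<le> 0)}"

definition outer_prod :: "real^'p \<Rightarrow> real^'p \<Rightarrow> real^'p^'p" where
  "outer_prod u v = (\<chi> j k. u $ j * v $ k)"

definition sample_cov :: "nat \<Rightarrow> (nat \<Rightarrow> real^'p) \<Rightarrow> real^'p \<Rightarrow> real^'p^'p" where
  "sample_cov n x \<mu> =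
     (1 / real n) *\<^sub>R (\<Sum>i=1..n. outer_prod (x i - \<mu>) (x i - \<mu>))"

(* 2/n times the Gaussian negative log-likelihood, up to an additive constant; meaningful only for
   det \<Omega> > 0, which holds on M_matrices. *)
definition neg_log_lik :: "real^'p^'p \<Rightarrow> real^'p^'p \<Rightarrow> real" where
  "neg_log_lik S \<Omega> = - ln (det \<Omega>) + trace (\<Omega> ** S)"

end

theory Submission
  imports Defs
begin

text \<open>
  Write \<open>f\<close> for the objective \<open>neg_log_lik S\<close>. Existence is a coercivity argument and
  uniqueness is strict convexity of \<open>- ln det\<close>; both rest on one fact of linear algebra, the
  simultaneous diagonalization of a positive definite and a symmetric matrix.

  Coercivity is where the sign constraints act. By Cauchy--Schwarz
  \<open>S\<^sub>j\<^sub>k \<le> sqrt (S\<^sub>j\<^sub>j S\<^sub>k\<^sub>k)\<close>, so excluding equality leaves a uniform \<open>r < 1\<close> with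
  \<open>S\<^sub>j\<^sub>k \<le> r sqrt (S\<^sub>j\<^sub>j S\<^sub>k\<^sub>k)\<close> for all \<open>j \<noteq> k\<close>. Thus \<open>S\<close> is dominated off the diagonal, and
  matched on it, by the positive definite matrix \<open>Z = (1 - r) diag S + r d d\<^sup>T\<close> with
  \<open>d\<^sub>j = sqrt S\<^sub>j\<^sub>j\<close>. Since an M-matrix has nonpositive off-diagonal entries,
  \<open>tr (\<Omega> S) \<ge> tr (\<Omega> Z) \<ge> (1 - r) \<Sum>\<^sub>j \<Omega>\<^sub>j\<^sub>j S\<^sub>j\<^sub>j \<ge> c tr \<Omega>\<close> with a constant \<open>c > 0\<close>
  (\<open>trace_coercive_on_M_matrices\<close>), even when \<open>S\<close> is singular. The inequality
  \<open>ln det X \<le> tr X - p\<close> at \<open>X = (c/2) \<Omega>\<close> absorbs the logarithm, leaving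
  \<open>f \<Omega> \<ge> (c/2) tr \<Omega> + const\<close> (\<open>neg_log_lik_coercive\<close>).

  A sublevel set of \<open>f\<close> therefore has bounded trace and, because \<open>tr (\<Omega> S) \<ge> 0\<close>, determinant
  bounded away from \<open>0\<close>. Such matrices lie in a compact set of M-matrices on which \<open>f\<close> is
  continuous, so a minimizer exists. If two minimizers differed, their midpoint, again an
  M-matrix, would have a strictly smaller value (\<open>neg_log_lik_midpoint_strict\<close>).
\<close>

section \<open>Simultaneous diagonalization\<close>

lemma symmetric_form_commute:
  fixes A :: "real^'n^'n"
  assumes "transpose A = A"
  shows "u \<bullet> (A *v v) = v \<bullet> (A *v u)"
  by (metis assms dot_lmul_matrix inner_commute transpose_matrix_vector)

lemma linear_coefficient_vanishes:
  fixes a b :: real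
  assumes "\<And>t. 0 \<le> 2 * t * a + t\<^sup>2 * b"
  shows "a = 0"
proof (rule ccontr)
  assume "a \<noteq> 0"
  define m where "m = \<bar>b\<bar> + 1"
  have m: "m > 0" "b < m" by (auto simp: m_def)
  have "0 \<le> 2 * (- a / m) * a + (- a / m)\<^sup>2 * b"
    by (rule assms)
  also have "\<dots> = (a\<^sup>2 / m\<^sup>2) * (b - 2 * m)"
    using m by (simp add: field_simps power2_eq_square)
  also have "\<dots> < 0"
    using m \<open>a \<noteq> 0\<close> by (intro mult_pos_neg) auto
  finally show False by simp
qed

text \<open>
  Moving from \<open>w\<close> by \<open>t u\<close> changes the form by \<open>2 t (u \<bullet> C w) + t\<^sup>2 (u \<bullet> C u)\<close>; at a zero of
  the form the linear term must vanish. It gives the eigenvector equation at a maximum of the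
  Rayleigh quotient, and the definiteness of nonsingular semidefinite matrices.
\<close>

lemma isotropic_vector_of_semidefinite_form:
  fixes C :: "real^'n^'n"
  assumes sym: "transpose C = C" and W: "subspace W"
    and psd: "\<And>u. u \<in> W \<Longrightarrow> 0 \<le> u \<bullet> (C *v u)"
    and "w \<in> W" "w \<bullet> (C *v w) = 0" "u \<in> W"
  shows "u \<bullet> (C *v w) = 0"
proof (rule linear_coefficient_vanishes)
  fix t :: real
  have "w + t *\<^sub>R u \<in> W"
    using W assms by (simp add: subspace_add subspace_scale)
  then have "0 \<le> (w + t *\<^sub>R u) \<bullet> (C *v (w + t *\<^sub>R u))"
    by (rule psd)
  also have "\<dots> = 2 * t * (u \<bullet> (C *v w)) + t\<^sup>2 * (u \<bullet> (C *v u))"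
    using symmetric_form_commute[OF sym, of w u] assms(5)
    by (simp add: matrix_vector_right_distrib matrix_vector_mult_scaleR inner_add_left inner_add_right
        power2_eq_square algebra_simps)
  finally show "0 \<le> 2 * t * (u \<bullet> (C *v w)) + t\<^sup>2 * (u \<bullet> (C *v u))" .
qed

text \<open>
  A partial solution of the generalized eigenvalue problem \<open>B e = l A e\<close>, orthonormal for the
  inner product of \<open>A\<close>. As a set, it can be enlarged one vector at a time.
\<close>

definition orthonormal_eigensystem :: "real^'n^'n \<Rightarrow> real^'n^'n \<Rightarrow> (real^'n) set \<Rightarrow> bool" where
  "orthonormal_eigensystem A B E \<longleftrightarrow> finite E \<and>
     (\<forall>e\<in>E. \<forall>f\<in>E. e \<bullet> (A *v f) = (if e = f then 1 else 0)) \<and>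
     (\<forall>e\<in>E. \<exists>l. B *v e = l *\<^sub>R (A *v e))"

text \<open>
  The new vector maximizes the Rayleigh quotient \<open>(w \<bullet> B w) / (w \<bullet> A w)\<close> over the
  \<open>A\<close>-orthogonal complement \<open>W\<close> of \<open>E\<close>. With \<open>l\<close> the maximal value, \<open>C = l A - B\<close> is
  semidefinite on \<open>W\<close> and isotropic at \<open>w\<close>, so \<open>C w\<close> is orthogonal to \<open>W\<close>; it is orthogonal to
  \<open>E\<close> because \<open>E\<close> consists of eigenvectors. As \<open>W\<close> and \<open>E\<close> span the space, \<open>C w = 0\<close>.
\<close>

lemma orthonormal_eigensystem_extend:
  fixes A B :: "real^'n^'n"
  assumes A: "pos_def_matrix A" and B: "transpose B = B"
    and E: "orthonormal_eigensystem A B E" and card: "card E < CARD('n)"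
  shows "\<exists>w. w \<notin> E \<and> orthonormal_eigensystem A B (insert w E)"
proof -
  have symA: "transpose A = A" and pos: "\<And>v. v \<noteq> 0 \<Longrightarrow> v \<bullet> (A *v v) > 0"
    using A by (auto simp: pos_def_matrix_def)
  have fin: "finite E" and orth: "\<And>e f. e \<in> E \<Longrightarrow> f \<in> E \<Longrightarrow> e \<bullet> (A *v f) = (if e = f then 1 else 0)"
    and eig: "\<And>e. e \<in> E \<Longrightarrow> \<exists>l. B *v e = l *\<^sub>R (A *v e)"
    using E by (auto simp: orthonormal_eigensystem_def)
  define W where "W = {w. \<forall>e\<in>E. e \<bullet> (A *v w) = 0}"
  have W: "subspace W"
    by (auto simp: W_def subspace_def matrix_vector_right_distrib matrix_vector_mult_scaleR inner_add_right)
  \<comment> \<open>\<open>W\<close> is the Euclidean complement of fewer than \<open>CARD('n)\<close> vectors, hence nontrivial\<close>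
  have "dim ((\<lambda>e. A *v e) ` E) < DIM(real^'n)"
  proof -
    have "dim ((\<lambda>e. A *v e) ` E) \<le> card ((\<lambda>e. A *v e) ` E)"
      using fin by (intro dim_le_card') auto
    also have "\<dots> \<le> card E" using fin by (rule card_image_le)
    finally show ?thesis using card by simp
  qed
  then obtain z where z: "z \<noteq> 0" "\<And>y. y \<in> span ((\<lambda>e. A *v e) ` E) \<Longrightarrow> orthogonal z y"
    using orthogonal_to_subspace_exists by blast
  have zW: "z \<in> W"
    using z(2) symmetric_form_commute[OF symA, of _ z]
    by (auto simp: W_def orthogonal_def intro: span_base)
  define K where "K = sphere 0 1 \<inter> W"
  have "closed W"
    using W by (rule closed_subspace)
  then have "compact K"
    by (auto simp: K_def intro: compact_Int_closed)
  moreover have "(1 / norm z) *\<^sub>R z \<in> K"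
    using z zW W by (simp add: K_def subspace_scale)
  moreover have "continuous_on K (\<lambda>w. (w \<bullet> (B *v w)) / (w \<bullet> (A *v w)))"
  proof (intro continuous_intros ballI)
    fix w assume "w \<in> K"
    then have "w \<noteq> 0" by (auto simp: K_def)
    then show "w \<bullet> (A *v w) \<noteq> 0" using pos[of w] by simp
  qed
  ultimately obtain w where w: "w \<in> K"
    and max: "\<And>u. u \<in> K \<Longrightarrow> (u \<bullet> (B *v u)) / (u \<bullet> (A *v u)) \<le> (w \<bullet> (B *v w)) / (w \<bullet> (A *v w))"
    using continuous_attains_sup[of K "\<lambda>w. (w \<bullet> (B *v w)) / (w \<bullet> (A *v w))"] by blast
  define l where "l = (w \<bullet> (B *v w)) / (w \<bullet> (A *v w))"
  define C where "C = l *\<^sub>R A - B"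
  have Cv: "C *v u = l *\<^sub>R (A *v u) - B *v u" for u
    by (simp add: C_def matrix_vector_mult_diff_rdistrib scaleR_matrix_vector_assoc)
  have symC: "transpose C = C"
    using symA B by (simp add: C_def transpose_def vec_eq_iff)
  have w0: "w \<noteq> 0" and wW: "w \<in> W" using w by (auto simp: K_def)
  have Apos: "w \<bullet> (A *v w) > 0" using pos w0 by blast
  have psd: "0 \<le> u \<bullet> (C *v u)" if "u \<in> W" for u
  proof (cases "u = 0")
    case False
    define v where "v = (1 / norm u) *\<^sub>R u"
    have uv: "u = norm u *\<^sub>R v" and v: "v \<in> K" "v \<noteq> 0"
      using False that W by (auto simp: v_def K_def subspace_scale)
    have "v \<bullet> (B *v v) \<le> l * (v \<bullet> (A *v v))"
      using max[OF v(1)] pos[OF v(2)] by (simp add: l_def pos_divide_le_eq)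
    then have "0 \<le> v \<bullet> (C *v v)"
      by (simp add: Cv inner_diff_right)
    moreover have "u \<bullet> (C *v u) = norm u * norm u * (v \<bullet> (C *v v))"
      by (subst (1 2) uv) (simp add: matrix_vector_mult_scaleR)
    ultimately show ?thesis by simp
  qed simp
  have wC: "w \<bullet> (C *v w) = 0"
    using Apos by (simp add: Cv inner_diff_right l_def)
  have CW: "u \<bullet> (C *v w) = 0" if "u \<in> W" for u
    using isotropic_vector_of_semidefinite_form[OF symC W psd wW wC that] by simp
  have CE: "e \<bullet> (C *v w) = 0" if e: "e \<in> E" for e
  proof -
    obtain m where "B *v e = m *\<^sub>R (A *v e)" using eig e by blast
    then have "e \<bullet> (B *v w) = m * (w \<bullet> (A *v e))"
      using symmetric_form_commute[OF B, of e w] by simp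
    moreover have "e \<bullet> (A *v w) = 0" using wW e by (auto simp: W_def)
    ultimately show ?thesis
      using symmetric_form_commute[OF symA, of e w] by (simp add: Cv inner_diff_right)
  qed
  have "C *v w = 0"
  proof -
    have "u \<bullet> (C *v w) = 0" for u
    proof -
      \<comment> \<open>the \<open>A\<close>-orthogonal projection of \<open>u\<close> onto the span of \<open>E\<close>\<close>
      define s where "s = (\<Sum>e\<in>E. (e \<bullet> (A *v u)) *\<^sub>R e)"
      have "f \<bullet> (A *v s) = f \<bullet> (A *v u)" if f: "f \<in> E" for f
      proof -
        have "f \<bullet> (A *v s) = s \<bullet> (A *v f)"
          by (rule symmetric_form_commute[OF symA])
        also have "\<dots> = (\<Sum>e\<in>E. (e \<bullet> (A *v u)) * (e \<bullet> (A *v f)))"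
          by (simp add: s_def inner_sum_left)
        also have "\<dots> = (\<Sum>e\<in>E. if e = f then e \<bullet> (A *v u) else 0)"
          using orth f by (intro sum.cong) auto
        also have "\<dots> = f \<bullet> (A *v u)"
          using f fin by simp
        finally show ?thesis .
      qed
      then have "u - s \<in> W"
        by (simp add: W_def matrix_vector_mult_diff_distrib inner_diff_right)
      then have "(u - s) \<bullet> (C *v w) = 0" by (rule CW)
      moreover have "s \<bullet> (C *v w) = 0"
        using CE by (simp add: s_def inner_sum_left)
      ultimately show ?thesis by (simp add: inner_diff_left)
    qed
    then show ?thesis by (metis inner_eq_zero_iff)
  qed
  then have Bw: "B *v w = l *\<^sub>R (A *v w)" by (simp add: Cv)
  define w' where "w' = (1 / sqrt (w \<bullet> (A *v w))) *\<^sub>R w"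
  have w'1: "w' \<bullet> (A *v w') = 1"
    using Apos by (simp add: w'_def matrix_vector_mult_scaleR)
  have w'W: "w' \<in> W" using wW W by (simp add: w'_def subspace_scale)
  have w'E: "w' \<bullet> (A *v e) = 0" "e \<bullet> (A *v w') = 0" if "e \<in> E" for e
    using w'W that symmetric_form_commute[OF symA, of w' e] by (auto simp: W_def)
  have "w' \<notin> E" using w'1 w'E by force
  moreover have "B *v w' = l *\<^sub>R (A *v w')"
    using Bw by (simp add: w'_def matrix_vector_mult_scaleR)
  ultimately have "orthonormal_eigensystem A B (insert w' E)"
    using fin orth eig w'1 w'E by (auto simp: orthonormal_eigensystem_def)
  with \<open>w' \<notin> E\<close> show ?thesis by blast
qed

text \<open>
  Extending the empty eigensystem until it has as many vectors as the dimension gives the columns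
  of \<open>P\<close>. The first equation also makes \<open>P\<close> invertible.
\<close>

lemma simultaneous_diagonalization:
  fixes A B :: "real^'n^'n"
  assumes A: "pos_def_matrix A" and B: "transpose B = B"
  obtains P :: "real^'n^'n" and l where
    "transpose P ** A ** P = mat 1"
    "transpose P ** B ** P = (\<chi> i j. if i = j then l i else 0)"
proof -
  have "\<exists>E. card E = k \<and> orthonormal_eigensystem A B E" if "k \<le> CARD('n)" for k
    using that
  proof (induction k)
    case 0
    show ?case
      by (intro exI[of _ "{}"]) (simp add: orthonormal_eigensystem_def)
  next
    case (Suc k)
    then obtain E where E: "card E = k" "orthonormal_eigensystem A B E" by auto
    then obtain w where "w \<notin> E" "orthonormal_eigensystem A B (insert w E)"
      using orthonormal_eigensystem_extend[OF A B E(2)] Suc.prems by auto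
    then show ?case
      using E by (intro exI[of _ "insert w E"]) (auto simp: orthonormal_eigensystem_def)
  qed
  then obtain E where E: "card E = CARD('n)" "orthonormal_eigensystem A B E" by blast
  have fin: "finite E" and orth: "\<And>e f. e \<in> E \<Longrightarrow> f \<in> E \<Longrightarrow> e \<bullet> (A *v f) = (if e = f then 1 else 0)"
    and eig: "\<And>e. e \<in> E \<Longrightarrow> \<exists>l. B *v e = l *\<^sub>R (A *v e)"
    using E by (auto simp: orthonormal_eigensystem_def)
  obtain b :: "'n \<Rightarrow> real^'n" where b: "bij_betw b UNIV E"
    using finite_same_card_bij[OF finite fin] E(1) by auto
  have bE: "b i \<in> E" and binj: "b i = b j \<longleftrightarrow> i = j" for i j
    using b by (auto simp: bij_betw_def inj_eq)
  obtain m where m: "\<And>e. e \<in> E \<Longrightarrow> B *v e = m e *\<^sub>R (A *v e)"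
    using eig by metis
  define P :: "real^'n^'n" where "P = (\<chi> i j. b j $ i)"
  have entry: "(transpose P ** X ** P) $ i $ j = b i \<bullet> (X *v b j)" for X :: "real^'n^'n" and i j
    unfolding matrix_mul_assoc[symmetric]
    by (simp add: P_def matrix_matrix_mult_def transpose_def inner_vec_def matrix_vector_mult_def)
  have orth_b: "b i \<bullet> (A *v b j) = (if i = j then 1 else 0)" for i j
    using orth[OF bE bE] by (simp add: binj)
  show thesis
  proof
    show "transpose P ** A ** P = mat 1"
      by (simp add: vec_eq_iff entry mat_def orth_b)
    show "transpose P ** B ** P = (\<chi> i j. if i = j then m (b i) else 0)"
      by (simp add: vec_eq_iff entry m[OF bE] orth_b)
  qed
qed

section \<open>Determinant inequalities for positive definite matrices\<close>

lemma pos_def_matrix_congruence: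
  fixes X P :: "real^'n^'n"
  assumes X: "pos_def_matrix X" and P: "det P \<noteq> 0"
  shows "pos_def_matrix (transpose P ** X ** P)"
  unfolding pos_def_matrix_def
proof (intro conjI allI impI)
  show "transpose (transpose P ** X ** P) = transpose P ** X ** P"
    using X by (simp add: pos_def_matrix_def matrix_transpose_mul matrix_mul_assoc)
next
  fix v :: "real^'n" assume "v \<noteq> 0"
  then have "P *v v \<noteq> 0"
    using P by (metis invertible_det_nz invertible_def matrix_vector_mul_assoc matrix_vector_mul_lid
        matrix_vector_mult_0_right)
  then have "0 < (P *v v) \<bullet> (X *v (P *v v))"
    using X by (simp add: pos_def_matrix_def)
  also have "\<dots> = v \<bullet> (transpose P ** X ** P *v v)"
    by (metis dot_lmul_matrix inner_commute matrix_vector_mul_assoc vector_transpose_matrix)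
  finally show "0 < v \<bullet> (transpose P ** X ** P *v v)" .
qed

lemma pos_def_matrix_diagonal_pos:
  assumes "pos_def_matrix X"
  shows "0 < X $ i $ i"
proof -
  have "0 < axis i 1 \<bullet> (X *v axis i 1)"
    using assms by (simp add: pos_def_matrix_def)
  then show ?thesis
    by (simp add: inner_axis' matrix_vector_mult_basis column_def)
qed

lemma pos_def_matrix_mat_1: "pos_def_matrix (mat 1 :: real^'n^'n)"
  by (simp add: pos_def_matrix_def transpose_mat)

lemma det_congruence:
  fixes X P :: "real^'n^'n"
  shows "det (transpose P ** X ** P) = (det P)\<^sup>2 * det X"
  by (simp add: det_mul power2_eq_square)

lemma simultaneous_diagonalization_pos_def:
  fixes A B :: "real^'n^'n"
  assumes A: "pos_def_matrix A" and B: "pos_def_matrix B"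
  obtains P :: "real^'n^'n" and l where
    "transpose P ** A ** P = mat 1"
    "transpose P ** B ** P = (\<chi> i j. if i = j then l i else 0)"
    "det P \<noteq> 0" "\<forall>i. l i > 0"
proof -
  have "transpose B = B" using B by (simp add: pos_def_matrix_def)
  then obtain P :: "real^'n^'n" and l where P: "transpose P ** A ** P = mat 1"
    "transpose P ** B ** P = (\<chi> i j. if i = j then l i else 0)"
    by (rule simultaneous_diagonalization[OF A])
  have "det P \<noteq> 0"
    using arg_cong[OF P(1), of det] by (auto simp: det_congruence)
  moreover have "l i > 0" for i
    using pos_def_matrix_diagonal_pos[OF pos_def_matrix_congruence[OF B \<open>det P \<noteq> 0\<close>], of i]
    by (simp add: P(2))
  ultimately show thesis using that[OF P] by simp
qed

lemma pos_def_matrix_det_pos: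
  fixes A :: "real^'n^'n"
  assumes "pos_def_matrix A"
  shows "0 < det A"
proof -
  obtain P :: "real^'n^'n" and l where P: "transpose P ** A ** P = mat 1"
    "transpose P ** A ** P = (\<chi> i j. if i = j then l i else 0)"
    "det P \<noteq> 0" "\<forall>i. l i > 0"
    by (rule simultaneous_diagonalization_pos_def[OF assms assms])
  have "(det P)\<^sup>2 * det A = 1"
    using arg_cong[OF P(1), of det] by (simp add: det_congruence)
  then show ?thesis
    by (metis zero_less_mult_pos zero_less_one zero_le_power2 less_eq_real_def mult_zero_left zero_neq_one)
qed

text \<open>
  In eigenvalues this is \<open>ln l \<le> l - 1\<close> summed. Diagonalizing \<open>X\<close> together with the identity
  makes \<open>P\<close> orthogonal, so that the trace is preserved as well.
\<close>

lemma ln_det_le_trace: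
  fixes X :: "real^'n^'n"
  assumes X: "pos_def_matrix X"
  shows "ln (det X) \<le> trace X - CARD('n)"
proof -
  obtain P :: "real^'n^'n" and l where P: "transpose P ** mat 1 ** P = mat 1"
    "transpose P ** X ** P = (\<chi> i j. if i = j then l i else 0)"
    "det P \<noteq> 0" "\<forall>i. l i > 0"
    by (rule simultaneous_diagonalization_pos_def[OF pos_def_matrix_mat_1 X])
  have PP: "transpose P ** P = mat 1" using P(1) by simp
  have PP': "P ** transpose P = mat 1" using PP by (simp add: matrix_left_right_inverse)
  have "(det P)\<^sup>2 = 1"
    using arg_cong[OF PP, of det] by (simp add: det_mul power2_eq_square)
  then have "det X = det (transpose P ** X ** P)" by (simp add: det_congruence)
  also have "\<dots> = (\<Prod>i\<in>UNIV. l i)"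
    unfolding P(2) by (subst det_diagonal) auto
  finally have "ln (det X) = (\<Sum>i\<in>UNIV. ln (l i))"
    using P(4) by (auto simp: less_le intro!: ln_prod)
  also have "\<dots> \<le> (\<Sum>i\<in>UNIV. l i - 1)"
    using P(4) by (intro sum_mono ln_le_minus_one) auto
  also have "\<dots> = trace (transpose P ** X ** P) - CARD('n)"
    by (simp add: P(2) trace_def sum_subtractf)
  also have "trace (transpose P ** X ** P) = trace X"
    by (metis PP' matrix_mul_assoc matrix_mul_rid trace_mul_sym)
  finally show ?thesis .
qed

lemma matrix_matrix_mult_add_rdistrib:
  fixes A B :: "real^'n^'m" and C :: "real^'k^'n"
  shows "(A + B) ** C = A ** C + B ** C"
  by (simp add: matrix_matrix_mult_def vec_eq_iff distrib_right sum.distrib)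

text \<open>
  Strict log-concavity of the determinant at midpoints. In coordinates in which \<open>A\<close> is the
  identity and \<open>B\<close> is diagonal it becomes \<open>l \<le> ((1 + l) / 2)\<^sup>2\<close> for each eigenvalue, strict as
  soon as \<open>l \<noteq> 1\<close>; and \<open>A \<noteq> B\<close> forces one such eigenvalue.
\<close>

lemma det_midpoint_strict:
  fixes A B :: "real^'n^'n"
  assumes A: "pos_def_matrix A" and B: "pos_def_matrix B" and "A \<noteq> B"
  shows "det A * det B < (det ((1/2) *\<^sub>R (A + B)))\<^sup>2"
proof -
  obtain P :: "real^'n^'n" and l where P: "transpose P ** A ** P = mat 1"
    "transpose P ** B ** P = (\<chi> i j. if i = j then l i else 0)"
    "det P \<noteq> 0" "\<forall>i. l i > 0"
    by (rule simultaneous_diagonalization_pos_def[OF A B])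
  have "\<exists>k. l k \<noteq> 1"
  proof (rule ccontr)
    assume "\<nexists>k. l k \<noteq> 1"
    then have l1: "l = (\<lambda>_. 1)" by auto
    have eq: "transpose P ** A ** P = transpose P ** B ** P"
      unfolding P mat_def l1 by (rule refl)
    obtain Q where Q: "P ** Q = mat 1"
      using P(3) invertible_det_nz invertible_def by blast
    then have Q': "transpose Q ** transpose P = mat 1"
      by (metis matrix_transpose_mul transpose_mat)
    have "X = transpose Q ** (transpose P ** X ** P) ** Q" for X
      by (metis Q Q' matrix_mul_assoc matrix_mul_lid matrix_mul_rid)
    then show False using eq \<open>A \<noteq> B\<close> by metis
  qed
  then obtain k where k: "l k \<noteq> 1" ..
  define d where "d = (det P)\<^sup>2"
  have d: "d > 0" using P(3) by (simp add: d_def)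
  have dA: "d * det A = 1"
    using arg_cong[OF P(1), of det] by (simp add: det_congruence d_def)
  have "d * det B = det (\<chi> i j. if i = j then l i else 0)"
    unfolding P(2)[symmetric] by (simp add: det_congruence d_def)
  then have dB: "d * det B = (\<Prod>i\<in>UNIV. l i)"
    by (subst (asm) det_diagonal) auto
  have "transpose P ** ((1/2) *\<^sub>R (A + B)) ** P
      = (1/2) *\<^sub>R (transpose P ** A ** P + transpose P ** B ** P)"
    by (simp add: matrix_add_ldistrib matrix_matrix_mult_add_rdistrib matrix_scalar_ac
        scaleR_add_right flip: scalar_matrix_assoc)
  also have "\<dots> = (\<chi> i j. if i = j then (1 + l i) / 2 else 0)"
    unfolding P by (simp add: vec_eq_iff mat_def)
  finally have "d * det ((1/2) *\<^sub>R (A + B)) = det (\<chi> i j. if i = j then (1 + l i) / 2 else 0)"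
    by (metis d_def det_congruence)
  then have dC: "d * det ((1/2) *\<^sub>R (A + B)) = (\<Prod>i\<in>UNIV. (1 + l i) / 2)"
    by (subst (asm) det_diagonal) auto
  have gap: "((1 + t) / 2)\<^sup>2 - t = ((1 - t) / 2)\<^sup>2" for t :: real
    by (simp add: power2_eq_square field_simps)
  have le: "t \<le> ((1 + t) / 2)\<^sup>2" for t :: real
    using gap[of t] zero_le_power2[of "(1 - t) / 2"] by linarith
  have less: "l k < ((1 + l k) / 2)\<^sup>2"
  proof -
    have "0 < ((1 - l k) / 2)\<^sup>2" using k by simp
    then show ?thesis using gap[of "l k"] by linarith
  qed
  have "d\<^sup>2 * (det A * det B) = (d * det A) * (d * det B)"
    by (simp add: power2_eq_square)
  also have "\<dots> = l k * (\<Prod>i\<in>UNIV - {k}. l i)"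
    by (simp add: dA dB prod.remove)
  also have "\<dots> < ((1 + l k) / 2)\<^sup>2 * (\<Prod>i\<in>UNIV - {k}. ((1 + l i) / 2)\<^sup>2)"
    using P(4) le less by (intro mult_less_le_imp_less prod_mono prod_pos) (auto intro: less_imp_le)
  also have "\<dots> = (\<Prod>i\<in>UNIV. ((1 + l i) / 2)\<^sup>2)"
    by (simp add: prod.remove[of UNIV k])
  also have "\<dots> = (d * det ((1/2) *\<^sub>R (A + B)))\<^sup>2"
    by (simp only: dC prod_power_distrib)
  also have "\<dots> = d\<^sup>2 * (det ((1/2) *\<^sub>R (A + B)))\<^sup>2"
    by (rule power_mult_distrib)
  finally show ?thesis using d by simp
qed

section \<open>Strict midpoint convexity of the objective\<close>

lemma M_matrices_midpoint:
  assumes "A \<in> M_matrices" "B \<in> M_matrices"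
  shows "(1/2) *\<^sub>R (A + B) \<in> M_matrices"
  using assms unfolding M_matrices_def pos_def_matrix_def
  by (auto simp: transpose_def vec_eq_iff matrix_vector_mult_add_rdistrib inner_add_right
      add_pos_pos add_nonpos_nonpos simp flip: scaleR_matrix_vector_assoc)

lemma neg_log_lik_midpoint_strict:
  fixes A B S :: "real^'n^'n"
  assumes A: "pos_def_matrix A" and B: "pos_def_matrix B" and "A \<noteq> B"
  shows "2 * neg_log_lik S ((1/2) *\<^sub>R (A + B)) < neg_log_lik S A + neg_log_lik S B"
proof -
  have pos: "det A > 0" "det B > 0"
    using A B by (auto intro: pos_def_matrix_det_pos)
  have strict: "det A * det B < (det ((1/2) *\<^sub>R (A + B)))\<^sup>2"
    using assms by (rule det_midpoint_strict)
  have "ln (det A) + ln (det B) = ln (det A * det B)"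
    using pos by (simp add: ln_mult)
  also have "\<dots> < ln ((det ((1/2) *\<^sub>R (A + B)))\<^sup>2)"
    using strict mult_pos_pos[OF pos] by (subst ln_less_cancel_iff) linarith+
  also have "\<dots> = 2 * ln (det ((1/2) *\<^sub>R (A + B)))"
    by (simp add: ln_realpow)
  finally have "ln (det A) + ln (det B) < 2 * ln (det ((1/2) *\<^sub>R (A + B)))" .
  moreover have "2 * trace ((1/2) *\<^sub>R (A + B) ** S) = trace (A ** S) + trace (B ** S)"
    by (simp add: trace_def matrix_matrix_mult_def sum_distrib_left sum.distrib algebra_simps)
  ultimately show ?thesis
    by (simp add: neg_log_lik_def)
qed

section \<open>Coercivity on M-matrices\<close>

lemma correlation_bound_uniform:
  fixes S :: "real^'n^'n"
  assumes "\<And>j. S $ j $ j > 0" and "\<And>j k. j \<noteq> k \<Longrightarrow> S $ j $ k < sqrt (S $ j $ j * S $ k $ k)"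
  obtains r where "0 \<le> r" "r < 1"
    "\<And>j k. j \<noteq> k \<Longrightarrow> S $ j $ k \<le> r * sqrt (S $ j $ j * S $ k $ k)"
proof -
  define q where "q = (\<lambda>(j, k). S $ j $ k / sqrt (S $ j $ j * S $ k $ k))"
  \<comment> \<open>inserting \<open>0\<close> secures \<open>0 \<le> r\<close>, and covers dimension one, where no \<open>j \<noteq> k\<close> exist\<close>
  define r where "r = Max (insert 0 (q ` {(j, k). j \<noteq> k}))"
  have pos: "sqrt (S $ j $ j * S $ k $ k) > 0" for j k using assms(1) by simp
  show thesis
  proof
    show "0 \<le> r" by (simp add: r_def)
    show "r < 1" using assms(2) pos by (auto simp: r_def q_def)
    fix j k :: 'n assume "j \<noteq> k"
    then have "q (j, k) \<le> r" by (auto simp: r_def intro: Max_ge)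
    then show "S $ j $ k \<le> r * sqrt (S $ j $ j * S $ k $ k)"
      using pos[of j k] by (simp add: q_def pos_divide_le_eq)
  qed
qed

text \<open>
  Comparison of \<open>S\<close> with \<open>(1 - r) diag S + r d d\<^sup>T\<close>, where \<open>d\<^sub>j = sqrt S\<^sub>j\<^sub>j\<close>: off the diagonal
  the comparison matrix is the larger one and \<open>\<Omega>\<close> is nonpositive, on the diagonal they agree,
  and the rank-one part contributes \<open>r (d \<bullet> \<Omega> d) \<ge> 0\<close>.
\<close>

lemma trace_coercive_on_M_matrices:
  fixes S :: "real^'n^'n"
  assumes pos: "\<And>j. S $ j $ j > 0" and corr: "\<And>j k. j \<noteq> k \<Longrightarrow> S $ j $ k < sqrt (S $ j $ j * S $ k $ k)"
  obtains c where "0 < c" "\<And>\<Omega>. \<Omega> \<in> M_matrices \<Longrightarrow> c * trace \<Omega> \<le> trace (\<Omega> ** S)"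
proof -
  obtain r where r: "0 \<le> r" "r < 1"
    and Sr: "\<And>j k. j \<noteq> k \<Longrightarrow> S $ j $ k \<le> r * sqrt (S $ j $ j * S $ k $ k)"
    using correlation_bound_uniform[of S] assms by metis
  define m where "m = Min (range (\<lambda>j. S $ j $ j))"
  have m: "0 < m" "\<And>j. m \<le> S $ j $ j"
    using pos by (auto simp: m_def)
  define d where "d = (\<chi> j. sqrt (S $ j $ j))"
  show thesis
  proof
    show "0 < (1 - r) * m" using r m by simp
    fix \<Omega> :: "real^'n^'n" assume M: "\<Omega> \<in> M_matrices"
    then have pd: "pos_def_matrix \<Omega>" and off: "\<And>j k. j \<noteq> k \<Longrightarrow> \<Omega> $ j $ k \<le> 0"
      by (auto simp: M_matrices_def)
    have "(1 - r) * m * trace \<Omega> = (\<Sum>j\<in>UNIV. (1 - r) * (\<Omega> $ j $ j * m))"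
      by (simp add: trace_def sum_distrib_left algebra_simps)
    also have "\<dots> \<le> (\<Sum>j\<in>UNIV. (1 - r) * (\<Omega> $ j $ j * S $ j $ j))"
      using r m pos_def_matrix_diagonal_pos[OF pd]
      by (intro sum_mono mult_left_mono) (auto intro: less_imp_le)
    also have "\<dots> \<le> (\<Sum>j\<in>UNIV. (1 - r) * (\<Omega> $ j $ j * S $ j $ j)) + r * (d \<bullet> (\<Omega> *v d))"
    proof -
      have "d \<noteq> 0" using pos by (auto simp: d_def vec_eq_iff) (metis less_irrefl)
      then have "d \<bullet> (\<Omega> *v d) > 0" using pd by (simp add: pos_def_matrix_def)
      then show ?thesis using r by simp
    qed
    also have "\<dots> = (\<Sum>j\<in>UNIV. \<Sum>k\<in>UNIV. (if j = k then (1 - r) * (\<Omega> $ j $ k * S $ k $ j) else 0)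
        + r * (d $ j * (\<Omega> $ j $ k * d $ k)))"
      by (simp add: sum.distrib inner_vec_def matrix_vector_mult_def sum_distrib_left)
    also have "\<dots> \<le> (\<Sum>j\<in>UNIV. \<Sum>k\<in>UNIV. \<Omega> $ j $ k * S $ k $ j)"
    proof (intro sum_mono)
      fix j k :: 'n
      show "(if j = k then (1 - r) * (\<Omega> $ j $ k * S $ k $ j) else 0)
          + r * (d $ j * (\<Omega> $ j $ k * d $ k)) \<le> \<Omega> $ j $ k * S $ k $ j"
      proof (cases "j = k")
        case True
        have "sqrt (S $ k $ k) * (\<Omega> $ k $ k * sqrt (S $ k $ k)) = \<Omega> $ k $ k * S $ k $ k"
          using pos[of k] by (simp add: algebra_simps flip: power2_eq_square)
        then show ?thesis
          using True pos[of k] by (simp add: d_def abs_of_pos algebra_simps)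
      next
        case False
        have "\<Omega> $ j $ k * (r * sqrt (S $ k $ k * S $ j $ j)) \<le> \<Omega> $ j $ k * S $ k $ j"
          using False off[OF False] Sr[of k j] by (intro mult_left_mono_neg) auto
        then show ?thesis using False by (simp add: d_def real_sqrt_mult algebra_simps)
      qed
    qed
    also have "\<dots> = trace (\<Omega> ** S)"
      by (simp add: trace_def matrix_matrix_mult_def)
    finally show "(1 - r) * m * trace \<Omega> \<le> trace (\<Omega> ** S)" .
  qed
qed

lemma det_scaleR:
  fixes A :: "real^'n^'n"
  shows "det (c *\<^sub>R A) = c ^ CARD('n) * det A"
proof -
  have "c *\<^sub>R A = mat c ** A"
    by (simp add: vec_eq_iff matrix_matrix_mult_def mat_def if_distrib[of "\<lambda>x. x * _"] cong: if_cong)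
  then show ?thesis
    by (simp add: det_mul) (simp add: mat_def det_diagonal)
qed

text \<open>
  Half of the linear term pays for the logarithm, by \<open>ln_det_le_trace\<close> at \<open>(c/2) \<Omega>\<close>.
\<close>

lemma neg_log_lik_coercive:
  fixes S \<Omega> :: "real^'n^'n"
  assumes pd: "pos_def_matrix \<Omega>" and c: "0 < c" "c * trace \<Omega> \<le> trace (\<Omega> ** S)"
  shows "c / 2 * trace \<Omega> + CARD('n) * (1 + ln (c / 2)) \<le> neg_log_lik S \<Omega>"
proof -
  have "pos_def_matrix ((c / 2) *\<^sub>R \<Omega>)"
    using pd c(1) by (auto simp: pos_def_matrix_def transpose_def vec_eq_iff simp flip: scaleR_matrix_vector_assoc)
  then have "ln (det ((c / 2) *\<^sub>R \<Omega>)) \<le> trace ((c / 2) *\<^sub>R \<Omega>) - CARD('n)"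
    by (rule ln_det_le_trace)
  moreover have "ln (det ((c / 2) *\<^sub>R \<Omega>)) = CARD('n) * ln (c / 2) + ln (det \<Omega>)"
    using c(1) pos_def_matrix_det_pos[OF pd] by (simp add: det_scaleR ln_mult ln_realpow)
  moreover have "trace ((c / 2) *\<^sub>R \<Omega>) = c / 2 * trace \<Omega>"
    by (simp add: trace_def sum_distrib_left)
  ultimately show ?thesis
    using c(2) by (simp add: neg_log_lik_def algebra_simps)
qed

section \<open>Compactness and existence of a minimizer\<close>

text \<open>
  The form at \<open>e\<^sub>j + e\<^sub>k\<close> and \<open>e\<^sub>j - e\<^sub>k\<close> gives \<open>2 \<bar>A\<^sub>j\<^sub>k\<bar> \<le> A\<^sub>j\<^sub>j + A\<^sub>k\<^sub>k\<close>, so a trace bound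
  bounds a semidefinite matrix.
\<close>

lemma psd_entry_le_trace:
  fixes A :: "real^'n^'n"
  assumes sym: "transpose A = A" and psd: "\<And>v. 0 \<le> v \<bullet> (A *v v)"
  shows "\<bar>A $ j $ k\<bar> \<le> trace A"
proof -
  have entry: "axis i 1 \<bullet> (A *v axis l 1) = A $ i $ l" for i l
    by (simp add: inner_axis' matrix_vector_mult_basis column_def)
  have diag: "0 \<le> A $ i $ i" for i
    using psd[of "axis i 1"] by (simp add: entry)
  have le: "A $ i $ i \<le> trace A" for i
    unfolding trace_def using diag by (intro member_le_sum) auto
  have "A $ k $ j = A $ j $ k"
    using sym by (metis transpose_def vec_lambda_beta)
  then have "0 \<le> A $ j $ j + A $ k $ k + 2 * A $ j $ k" "0 \<le> A $ j $ j + A $ k $ k - 2 * A $ j $ k"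
    using psd[of "axis j 1 + axis k 1"] psd[of "axis j 1 - axis k 1"]
    by (simp_all add: entry matrix_vector_right_distrib matrix_vector_mult_diff_distrib
        inner_add_left inner_add_right inner_diff_left inner_diff_right)
  then show ?thesis using le[of j] le[of k] by linarith
qed

lemma psd_det_nonzero_imp_pos_def:
  fixes A :: "real^'n^'n"
  assumes sym: "transpose A = A" and psd: "\<And>v. 0 \<le> v \<bullet> (A *v v)" and det: "det A \<noteq> 0"
  shows "pos_def_matrix A"
  unfolding pos_def_matrix_def
proof (intro conjI allI impI)
  fix v :: "real^'n" assume "v \<noteq> 0"
  have "v \<bullet> (A *v v) \<noteq> 0"
  proof
    assume "v \<bullet> (A *v v) = 0"
    then have "u \<bullet> (A *v v) = 0" for u
      using isotropic_vector_of_semidefinite_form[OF sym subspace_UNIV psd] by simp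
    then have "A *v v = 0" by (metis inner_eq_zero_iff)
    with det \<open>v \<noteq> 0\<close> show False
      by (metis invertible_det_nz invertible_def matrix_vector_mul_assoc matrix_vector_mul_lid
        matrix_vector_mult_0_right)
  qed
  then show "0 < v \<bullet> (A *v v)" using psd[of v] by linarith
qed (fact sym)

lemma continuous_on_det [continuous_intros]:
  fixes f :: "'a::topological_space \<Rightarrow> real^'n^'n"
  shows "continuous_on X f \<Longrightarrow> continuous_on X (\<lambda>x. det (f x))"
  unfolding det_def by (intro continuous_intros)

lemma continuous_on_trace [continuous_intros]:
  fixes f :: "'a::topological_space \<Rightarrow> real^'n^'n"
  shows "continuous_on X f \<Longrightarrow> continuous_on X (\<lambda>x. trace (f x))"
  unfolding trace_def by (intro continuous_intros)

text \<open>
  Semidefiniteness is a closed condition whereas definiteness is open. For \<open>\<delta> > 0\<close> the determinant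
  bound restores definiteness, so that this set is compact and still consists of M-matrices.
\<close>

definition bounded_M_matrices :: "real \<Rightarrow> real \<Rightarrow> (real^'n^'n) set" where
  "bounded_M_matrices T \<delta> = {\<Omega>. transpose \<Omega> = \<Omega> \<and> (\<forall>v. 0 \<le> v \<bullet> (\<Omega> *v v)) \<and>
     (\<forall>j k. j \<noteq> k \<longrightarrow> \<Omega> $ j $ k \<le> 0) \<and> trace \<Omega> \<le> T \<and> \<delta> \<le> det \<Omega>}"

lemma compact_bounded_M_matrices: "compact (bounded_M_matrices T \<delta> :: (real^'n^'n) set)"
  unfolding compact_eq_bounded_closed
proof
  let ?N = "real CARD('n)"
  show "bounded (bounded_M_matrices T \<delta> :: (real^'n^'n) set)"
    unfolding bounded_iff
  proof (intro exI ballI)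
    fix \<Omega> :: "real^'n^'n" assume \<Omega>: "\<Omega> \<in> bounded_M_matrices T \<delta>"
    have entry: "\<bar>\<Omega> $ j $ k\<bar> \<le> T" for j k
      using psd_entry_le_trace[of \<Omega> j k] \<Omega> by (force simp: bounded_M_matrices_def)
    have "norm \<Omega> \<le> (\<Sum>j\<in>UNIV. norm (\<Omega> $ j))"
      unfolding norm_vec_def by (rule L2_set_le_sum) simp
    also have "\<dots> \<le> (\<Sum>j\<in>(UNIV :: 'n set). \<Sum>k\<in>(UNIV :: 'n set). T)"
      using entry by (intro sum_mono order_trans[OF norm_le_l1_cart]) auto
    finally show "norm \<Omega> \<le> ?N * (?N * T)" by simp
  qed
  show "closed (bounded_M_matrices T \<delta> :: (real^'n^'n) set)"
    unfolding bounded_M_matrices_def transpose_def vec_eq_iff inner_vec_def matrix_vector_mult_def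
    by (simp, intro closed_Collect_conj closed_Collect_all closed_Collect_imp closed_Collect_le
        closed_Collect_eq open_Collect_const continuous_intros)
qed

lemma bounded_M_matrices_subset:
  assumes "0 < \<delta>"
  shows "bounded_M_matrices T \<delta> \<subseteq> M_matrices"
  using assms psd_det_nonzero_imp_pos_def by (fastforce simp: bounded_M_matrices_def M_matrices_def)

text \<open>
  The sublevel set of the identity matrix lies in a compact set \<open>K\<close> of M-matrices, so a minimizer
  over \<open>K\<close> is a minimizer over all M-matrices.
\<close>

lemma neg_log_lik_minimizer_exists:
  fixes S :: "real^'n^'n"
  assumes "\<And>j. S $ j $ j > 0" and "\<And>j k. j \<noteq> k \<Longrightarrow> S $ j $ k < sqrt (S $ j $ j * S $ k $ k)"
  shows "\<exists>\<Omega>\<in>M_matrices. \<forall>\<Omega>'\<in>M_matrices. neg_log_lik S \<Omega> \<le> neg_log_lik S \<Omega>'"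
proof -
  obtain c where c: "0 < c" and tr: "\<And>\<Omega>. \<Omega> \<in> M_matrices \<Longrightarrow> c * trace \<Omega> \<le> trace (\<Omega> ** S)"
    using trace_coercive_on_M_matrices[of S] assms by metis
  define F where "F = neg_log_lik S (mat 1)"
  define T where "T = (F - CARD('n) * (1 + ln (c / 2))) / (c / 2)"
  define K where "K = (bounded_M_matrices T (exp (- F)) :: (real^'n^'n) set)"
  have KM: "K \<subseteq> M_matrices"
    unfolding K_def by (rule bounded_M_matrices_subset) simp
  have sub: "\<Omega> \<in> K" if M: "\<Omega> \<in> M_matrices" and le: "neg_log_lik S \<Omega> \<le> F" for \<Omega>
  proof -
    have pd: "pos_def_matrix \<Omega>" using M by (simp add: M_matrices_def)
    have psd: "0 \<le> v \<bullet> (\<Omega> *v v)" for v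
      using pd by (cases "v = 0") (auto simp: pos_def_matrix_def intro: less_imp_le)
    have "trace \<Omega> \<le> T"
      using neg_log_lik_coercive[OF pd c tr[OF M]] le c by (simp add: T_def field_simps)
    moreover have "exp (- F) \<le> det \<Omega>"
    proof -
      have "0 \<le> trace \<Omega>"
        using pos_def_matrix_diagonal_pos[OF pd] by (auto simp: trace_def intro: sum_nonneg less_imp_le)
      then have "0 \<le> c * trace \<Omega>" using c by simp
      then have "- F \<le> ln (det \<Omega>)"
        using le tr[OF M] by (simp add: neg_log_lik_def)
      then show ?thesis
        using pos_def_matrix_det_pos[OF pd] by (simp add: ln_ge_iff)
    qed
    ultimately show ?thesis
      using M psd by (simp add: K_def bounded_M_matrices_def M_matrices_def pos_def_matrix_def)
  qed
  have I: "(mat 1 :: real^'n^'n) \<in> M_matrices"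
    by (simp add: M_matrices_def pos_def_matrix_mat_1) (simp add: mat_def)
  have "continuous_on K (neg_log_lik S)"
    unfolding neg_log_lik_def matrix_matrix_mult_def
  proof (intro continuous_intros ballI)
    fix \<Omega> assume "\<Omega> \<in> K"
    then have "exp (- F) \<le> det \<Omega>" by (simp add: K_def bounded_M_matrices_def)
    then show "det \<Omega> \<noteq> 0" using exp_gt_zero[of "- F"] by linarith
  qed
  moreover have "mat 1 \<in> K" using sub[OF I] by (simp add: F_def)
  ultimately obtain \<Omega> where \<Omega>: "\<Omega> \<in> K" "\<And>\<Omega>'. \<Omega>' \<in> K \<Longrightarrow> neg_log_lik S \<Omega> \<le> neg_log_lik S \<Omega>'"
    using continuous_attains_inf[of K "neg_log_lik S"] compact_bounded_M_matrices K_def by blast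
  have "neg_log_lik S \<Omega> \<le> neg_log_lik S \<Omega>'" if "\<Omega>' \<in> M_matrices" for \<Omega>'
  proof (cases "neg_log_lik S \<Omega>' \<le> F")
    case True
    then show ?thesis using sub that \<Omega>(2) by blast
  next
    case False
    then show ?thesis using \<Omega>(2)[OF \<open>mat 1 \<in> K\<close>] by (simp add: F_def)
  qed
  then show ?thesis using \<Omega>(1) KM by blast
qed

section \<open>The theorem for sample covariances\<close>

lemma sample_cov_le_sqrt_diagonal:
  "sample_cov n x \<mu> $ j $ k \<le> sqrt (sample_cov n x \<mu> $ j $ j * sample_cov n x \<mu> $ k $ k)"
proof -
  define y where "y i l = (x i - \<mu>) $ l" for i l
  have entry: "sample_cov n x \<mu> $ j $ k = (1 / real n) * (\<Sum>i=1..n. y i j * y i k)" for j k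
    by (simp add: sample_cov_def outer_prod_def y_def)
  have "(\<Sum>i=1..n. y i j * y i k)\<^sup>2 \<le> (\<Sum>i=1..n. (y i j)\<^sup>2) * (\<Sum>i=1..n. (y i k)\<^sup>2)"
    by (rule Cauchy_Schwarz_ineq_sum)
  then have "(1 / real n)\<^sup>2 * (\<Sum>i=1..n. y i j * y i k)\<^sup>2
      \<le> (1 / real n)\<^sup>2 * ((\<Sum>i=1..n. (y i j)\<^sup>2) * (\<Sum>i=1..n. (y i k)\<^sup>2))"
    by (intro mult_left_mono) auto
  then have "(sample_cov n x \<mu> $ j $ k)\<^sup>2 \<le> sample_cov n x \<mu> $ j $ j * sample_cov n x \<mu> $ k $ k"
    unfolding entry by (simp add: power2_eq_square algebra_simps)
  then show ?thesis by (rule real_le_rsqrt)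
qed

theorem theorem1:
  fixes x :: "nat \<Rightarrow> real^'p" and \<mu> :: "real^'p" and n :: nat and S :: "real^'p^'p"
  assumes "n \<ge> 1"
    and "S = sample_cov n x \<mu>"
    and "\<forall>j. S $ j $ j > 0"
    and "\<not> (\<exists>j k. j \<noteq> k \<and> S $ j $ k = sqrt (S $ j $ j * S $ k $ k))"
  shows "\<exists>!\<Omega>. is_arg_min (neg_log_lik S) (\<lambda>\<Omega>. \<Omega> \<in> M_matrices) \<Omega>"
proof -
  have "S $ j $ k < sqrt (S $ j $ j * S $ k $ k)" if "j \<noteq> k" for j k
    using sample_cov_le_sqrt_diagonal[of n x \<mu> j k] assms(2,4) that by (metis order_less_le)
  then obtain A where A: "A \<in> M_matrices"
    and min: "\<And>\<Omega>. \<Omega> \<in> M_matrices \<Longrightarrow> neg_log_lik S A \<le> neg_log_lik S \<Omega>"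
    using neg_log_lik_minimizer_exists[of S] assms(3) by metis
  show ?thesis
  proof (intro ex1I)
    show "is_arg_min (neg_log_lik S) (\<lambda>\<Omega>. \<Omega> \<in> M_matrices) A"
      using A min by (simp add: is_arg_min_linorder)
    fix B assume "is_arg_min (neg_log_lik S) (\<lambda>\<Omega>. \<Omega> \<in> M_matrices) B"
    then have B: "B \<in> M_matrices" "neg_log_lik S B \<le> neg_log_lik S A"
      using A by (simp_all add: is_arg_min_linorder)
    show "B = A"
    proof (rule ccontr)
      assume "B \<noteq> A"
      then have "2 * neg_log_lik S ((1/2) *\<^sub>R (A + B)) < neg_log_lik S A + neg_log_lik S B"
        using A B by (intro neg_log_lik_midpoint_strict) (auto simp: M_matrices_def)
      with min[OF M_matrices_midpoint[OF A B(1)]] B(2) show False by linarith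
    qed
  qed
qed

end
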